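(* Let $1\le k<n$ and let $B\in\mathcal{PC}_k$. If $k=n-1$, assume moreover that $B$ is inconsistent (if $k\le n-2$, $B$ may be consistent or inconsistent). Then there exists $A\in\mathcal{PC}_n$ such that $A[\{1,\ldots,k\}]=B$ and the Perron vector of $A$ is inefficient for $A$.
   Context: $\mathcal{PC}_n$ denotes the set of $n\times n$ reciprocal matrices, i.e. real matrices $A=[a_{ij}]$ with all entries positive and $a_{ji}=1/a_{ij}$ for all $i,j$ (so $a_{ii}=1$). A reciprocal matrix $A$ is consistent if $a_{ij}a_{jk}=a_{ik}$ for all $i,j,k$, and inconsistent otherwise. The Perron vector of a positive square matrix is any entrywise positive (right) eigenvector (unique up to positive scalar multiple). $A[K]$ is the principal submatrix of $A$ formed by the rows and columns indexed by $K$. A positive $n$-vector $w$ is efficient for $A\in\mathcal{PC}_n$ if, for every positive $n$-vector $v$, the inequalities $|a_{ij}-v_i/v_j|\le|a_{ij}-w_i/w_j|$ for all $i,j$ imply that $v$ is a positive scalar multiple of $w$; otherwise $w$ is inefficient for $A$.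
   Formalization: The case k = 1, n = 3 is excluded: there the claim is false, since the Perron vector of every 3×3 reciprocal matrix is efficient. *)

theory Defs
  imports Complex_Main "Jordan_Normal_Form.Char_Poly" "Jordan_Normal_Form.DL_Submatrix"
begin

(* Matrices and vectors are indexed from 0, so that the index set {1,...,k} becomes {..<k}. *)

definition reciprocal_mats :: "nat \<Rightarrow> real mat set" where
  "reciprocal_mats n =
     {A \<in> carrier_mat n n. \<forall>i<n. \<forall>j<n. A $$ (i, j) > 0 \<and> A $$ (j, i) = 1 / A $$ (i, j)}"

definition consistent :: "real mat \<Rightarrow> bool" where
  "consistent A \<longleftrightarrow>
     (\<forall>i<dim_row A. \<forall>j<dim_row A. \<forall>k<dim_row A. A $$ (i, j) * A $$ (j, k) = A $$ (i, k))"

definition positive_vec :: "nat \<Rightarrow> real vec \<Rightarrow> bool" where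
  "positive_vec n w \<longleftrightarrow> w \<in> carrier_vec n \<and> (\<forall>i<n. w $ i > 0)"

definition perron_vector :: "real mat \<Rightarrow> real vec \<Rightarrow> bool" where
  "perron_vector A w \<longleftrightarrow> positive_vec (dim_row A) w \<and> (\<exists>l. eigenvector A w l)"

definition efficient :: "real mat \<Rightarrow> real vec \<Rightarrow> bool" where
  "efficient A w \<longleftrightarrow> positive_vec (dim_row A) w \<and>
     (\<forall>v. positive_vec (dim_row A) v \<longrightarrow>
        (\<forall>i<dim_row A. \<forall>j<dim_row A.
           \<bar>A $$ (i, j) - v $ i / v $ j\<bar> \<le> \<bar>A $$ (i, j) - w $ i / w $ j\<bar>) \<longrightarrow>
        (\<exists>c>0. v = c \<cdot>\<^sub>v w))"

definition inefficient :: "real mat \<Rightarrow> real vec \<Rightarrow> bool" where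
  "inefficient A w \<longleftrightarrow> positive_vec (dim_row A) w \<and> \<not> efficient A w"

(* Every Perron vector of a 3-by-3 reciprocal matrix is efficient. Hence a 1-by-1 matrix has
   no reciprocal 3-by-3 extension with an inefficient Perron vector. *)

lemma cyclic_eq:
  fixes x y z :: real
  assumes "x > 0" "y > 0" "z > 0" "x + 1 / z = y + 1 / x" "y + 1 / x = z + 1 / y"
  shows "x = y \<and> y = z"
proof -
  have m: "1 / a < 1 / b \<longleftrightarrow> b < a" if "a > 0" "b > 0" for a b :: real
    using that by (simp add: field_simps)
  have a: "x < y \<longleftrightarrow> z < x" using assms(4) m[of x z] assms(1,3) by linarith
  have b: "y < z \<longleftrightarrow> x < y" using assms(5) m[of y x] assms(1,2) by linarith
  have a': "y < x \<longleftrightarrow> x < z" using assms(4) m[of z x] assms(1,3) by linarith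
  have b': "z < y \<longleftrightarrow> y < x" using assms(5) m[of x y] assms(1,2) by linarith
  show ?thesis using a b a' b' by linarith
qed

lemma ratio_le:
  fixes a p q r s :: real
  assumes pos: "p > 0" "q > 0" "r > 0" "s > 0"
    and "a \<le> r / s" and "\<bar>a - p / q\<bar> \<le> \<bar>a - r / s\<bar>"
  shows "p / r \<le> q / s"
proof -
  have "p / q \<le> r / s" using assms(5,6) by linarith
  then show ?thesis using pos by (simp add: field_simps)
qed

lemma perron_vector_3_efficient:
  assumes A: "A \<in> reciprocal_mats 3" and P: "perron_vector A w"
  shows "efficient A w"
proof -
  have dr: "dim_row A = 3" "dim_col A = 3"
    and ap: "\<And>i j. i < 3 \<Longrightarrow> j < 3 \<Longrightarrow> A $$ (i, j) > 0"
    and ar: "\<And>i j. i < 3 \<Longrightarrow> j < 3 \<Longrightarrow> A $$ (j, i) = 1 / A $$ (i, j)"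
    using A unfolding reciprocal_mats_def carrier_mat_def by blast+
  from P dr obtain l where pw: "positive_vec 3 w" and ev: "A *\<^sub>v w = l \<cdot>\<^sub>v w"
    by (auto simp: perron_vector_def eigenvector_def)
  have dw: "dim_vec w = 3" using pw by (auto simp: positive_vec_def)
  have wp: "w $ 0 > 0" "w $ 1 > 0" "w $ 2 > 0" using pw by (auto simp: positive_vec_def)
  have row: "A $$ (i, 0) * w $ 0 + A $$ (i, 1) * w $ 1 + A $$ (i, 2) * w $ 2 = l * w $ i"
    if "i < 3" for i
  proof -
    have "(A *\<^sub>v w) $ i = l * w $ i" using ev that dw by simp
    moreover have "{0..<3::nat} = {0, 1, 2}" by auto
    ultimately show ?thesis using that dr dw by (simp add: scalar_prod_def add.assoc)
  qed
  define x y z where "x = A $$ (0, 1) * w $ 1 / w $ 0" and "y = A $$ (1, 2) * w $ 2 / w $ 1"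
    and "z = A $$ (2, 0) * w $ 0 / w $ 2"
  have p3: "A $$ (0, 1) > 0" "A $$ (1, 2) > 0" "A $$ (2, 0) > 0" using ap by auto
  have pos: "x > 0" "y > 0" "z > 0" using p3 wp by (auto simp: x_def y_def z_def)
  have d: "A $$ (i, i) = 1" if "i < 3" for i
  proof -
    obtain a where a: "a = A $$ (i, i)" by simp
    have "a > 0" "a = 1 / a" using ar[OF that that] ap[OF that that] unfolding a by blast+
    then have "a * a = 1" by (metis less_irrefl nonzero_eq_divide_eq)
    then show ?thesis using \<open>a > 0\<close> square_eq_1_iff[of a] unfolding a by linarith
  qed
  have rec: "A $$ (1, 0) = 1 / A $$ (0, 1)" "A $$ (2, 1) = 1 / A $$ (1, 2)"
    "A $$ (0, 2) = 1 / A $$ (2, 0)"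
    using ar[of 0 1] ar[of 1 2] ar[of 2 0] by simp_all
  have r: "A $$ (i, 0) * w $ 0 / w $ i + A $$ (i, 1) * w $ 1 / w $ i + A $$ (i, 2) * w $ 2 / w $ i = l"
    if "i < 3" "w $ i > 0" for i
    unfolding add_divide_distrib[symmetric] row[OF that(1)] using that(2) by simp
  have "1 + x + 1 / z = l" using r[of 0] wp p3 d[of 0] rec by (simp add: x_def z_def)
  moreover have "1 / x + 1 + y = l" using r[of 1] wp p3 d[of 1] rec by (simp add: x_def y_def)
  moreover have "z + 1 / y + 1 = l" using r[of 2] wp p3 d[of 2] rec by (simp add: y_def z_def)
  ultimately have "x = y \<and> y = z" using cyclic_eq[OF pos] by linarith
  then have eq: "y = x" "z = x" by auto
  have "\<exists>c>0. v = c \<cdot>\<^sub>v w"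
    if pv: "positive_vec 3 v"
      and le: "\<And>i j. i < 3 \<Longrightarrow> j < 3 \<Longrightarrow>
        \<bar>A $$ (i, j) - v $ i / v $ j\<bar> \<le> \<bar>A $$ (i, j) - w $ i / w $ j\<bar>" for v
  proof -
    have vp: "v $ 0 > 0" "v $ 1 > 0" "v $ 2 > 0" and dv: "dim_vec v = 3"
      using pv by (auto simp: positive_vec_def)
    have q: "v $ 0 / w $ 0 = v $ 1 / w $ 1 \<and> v $ 1 / w $ 1 = v $ 2 / w $ 2"
    proof (cases "x \<le> 1")
      case True
      then have "x \<le> 1" "y \<le> 1" "z \<le> 1" using eq by auto
      then have "A $$ (0, 1) \<le> w $ 0 / w $ 1" "A $$ (1, 2) \<le> w $ 1 / w $ 2" "A $$ (2, 0) \<le> w $ 2 / w $ 0"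
        using wp by (auto simp: x_def y_def z_def field_simps)
      then have "v $ 0 / w $ 0 \<le> v $ 1 / w $ 1" "v $ 1 / w $ 1 \<le> v $ 2 / w $ 2"
        "v $ 2 / w $ 2 \<le> v $ 0 / w $ 0"
        by (auto intro!: ratio_le[OF _ _ _ _ _ le] vp[simplified] wp[simplified])
      then show ?thesis by linarith
    next
      case False
      then have "x \<ge> 1" "y \<ge> 1" "z \<ge> 1" using eq by auto
      then have "A $$ (1, 0) \<le> w $ 1 / w $ 0" "A $$ (2, 1) \<le> w $ 2 / w $ 1"
        "A $$ (0, 2) \<le> w $ 0 / w $ 2"
        using wp p3 unfolding rec by (auto simp: x_def y_def z_def field_simps)
      then have "v $ 1 / w $ 1 \<le> v $ 0 / w $ 0" "v $ 2 / w $ 2 \<le> v $ 1 / w $ 1"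
        "v $ 0 / w $ 0 \<le> v $ 2 / w $ 2"
        by (auto intro!: ratio_le[OF _ _ _ _ _ le] vp[simplified] wp[simplified])
      then show ?thesis by linarith
    qed
    define c where "c = v $ 0 / w $ 0"
    have "c = v $ 0 / w $ 0" "c = v $ 1 / w $ 1" "c = v $ 2 / w $ 2" using q c_def by linarith+
    then have c: "v $ 0 = c * w $ 0" "v $ 1 = c * w $ 1" "v $ 2 = c * w $ 2"
      using wp by (metis less_irrefl nonzero_eq_divide_eq)+
    have "v = c \<cdot>\<^sub>v w"
    proof (rule eq_vecI)
      fix i assume "i < dim_vec (c \<cdot>\<^sub>v w)"
      then have i: "i < 3" using dw by simp
      then have "i = 0 \<or> i = 1 \<or> i = 2" by auto
      then show "v $ i = (c \<cdot>\<^sub>v w) $ i" using c i dw by auto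
    qed (simp add: dv dw)
    then show ?thesis using vp wp by (auto simp: c_def intro!: exI[of _ "v $ 0 / w $ 0"])
  qed
  then show ?thesis using pw unfolding efficient_def dr by blast
qed

end

theory Submission
  imports Defs "HOL-Analysis.Function_Topology"
begin

text \<open>
  It is enough to extend an inconsistent reciprocal matrix \<open>C\<close> of size \<open>m = n - 1\<close> by one row and
  column. For \<open>k = m\<close> the matrix \<open>B\<close> is itself inconsistent. For \<open>k < m\<close> the assumptions give \<open>m \<ge> 3\<close>, and then
  \<open>B\<close> is a leading block of such a \<open>C\<close>, as the free entries can spoil one triple
  (\<open>inconsistent_extension\<close>).

  Let \<open>u\<close> be a Perron vector of \<open>C\<close> and \<open>r\<close> its eigenvalue. Take \<open>t u\<close> as the new last column, so that
  the new last row has the entries \<open>1 / (t u_j)\<close>. The vector \<open>(u, 1)\<close> satisfies the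
  eigenvalue equation for \<open>t + r\<close> in the first \<open>m\<close> rows, and in the last row the equation reads
  \<open>t (t + r - 1) = m\<close>.
  The inconsistency of \<open>C\<close> gives \<open>r > m\<close> (\<open>inconsistent_perron_root_gt\<close>), so this equation has a root
  \<open>t\<close> strictly between 0 and 1. In the last row every off-diagonal entry \<open>a_j = 1 / (t u_j)\<close> thus
  exceeds the ratio \<open>1 / u_j\<close> of weights that is meant to approximate it. Increasing the last
  weight a little improves all these approximations, and the reciprocal ones, at once
  (\<open>inefficient_if_dominated_entry\<close>). Hence \<open>(u, 1)\<close> is inefficient, and so is every other Perron
  vector, being a multiple of \<open>(u, 1)\<close> (\<open>positive_eigenvector_unique\<close>).

  The only part of Perron's theorem that takes an effort is the existence of \<open>u\<close>
  (\<open>positive_eigenvector_exists\<close>).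
\<close>

section \<open>Perron vectors of positive matrices\<close>

text \<open>
  Collatz and Wielandt: among the pairs \<open>(u, r)\<close> with \<open>u\<close> in the standard simplex and \<open>r u \<le> a u\<close>
  entrywise, one with maximal \<open>r\<close> exists by compactness. If one of its inequalities were strict,
  then all of them would be strict for \<open>a u\<close> in place of \<open>u\<close>, because \<open>a\<close> is positive, and \<open>r\<close>
  could be increased.
\<close>

lemma positive_eigenvector_exists:
  fixes a :: "nat \<Rightarrow> nat \<Rightarrow> real"
  assumes n: "n > 0" and pos: "\<And>i j. i < n \<Longrightarrow> j < n \<Longrightarrow> a i j > 0"
  shows "\<exists>u r. (\<forall>i<n. u i > 0) \<and> (\<forall>i<n. (\<Sum>j<n. a i j * u j) = r * u i)"
proof -
  define R where "R = (\<Sum>i<n. \<Sum>j<n. a i j)"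
  define M where "M = (\<lambda>u i. \<Sum>j<n. a i j * u j)"
  \<comment> \<open>Vectors are functions on all of \<open>nat\<close>, so compactness is Tychonoff's theorem for the cube; the entries
     from \<open>n\<close> on only have to stay in the unit interval.\<close>
  define D :: "((nat \<Rightarrow> real) \<times> real) set" where "D = (PiE UNIV (\<lambda>_. {0..1})) \<times> {0..R}"
  define S where "S = D \<inter> ({p. (\<Sum>j<n. fst p j) = 1} \<inter> (\<Inter>i\<in>{..<n}. {p. snd p * fst p i \<le> M (fst p) i}))"
  have R0: "R \<ge> 0" unfolding R_def using pos by (intro sum_nonneg) (auto intro: less_imp_le)
  have coord: "continuous_on UNIV (\<lambda>p::(nat \<Rightarrow> real) \<times> real. fst p i)" for i
    by (rule continuous_on_product_then_coordinatewise) (rule continuous_on_fst[OF continuous_on_id])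
  have "compact (PiE UNIV (\<lambda>_. {0..1}) :: (nat \<Rightarrow> real) set)"
    using compactin_PiE[where X = "\<lambda>_::nat. euclidean :: real topology" and I = UNIV and S = "\<lambda>_. {0..1}"]
    by (simp add: euclidean_product_topology)
  then have "compact D" unfolding D_def by (intro compact_Times) auto
  moreover have "closed ({p::(nat \<Rightarrow> real) \<times> real. (\<Sum>j<n. fst p j) = 1} \<inter>
      (\<Inter>i\<in>{..<n}. {p. snd p * fst p i \<le> M (fst p) i}))"
    unfolding M_def
    by (intro closed_Int closed_INT ballI closed_Collect_eq closed_Collect_le continuous_intros coord)
  ultimately have comp: "compact S" unfolding S_def by (rule compact_Int_closed)
  \<comment> \<open>the bound \<open>R\<close> on the value, built into \<open>D\<close> for compactness, excludes no pair\<close>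
  have MR: "q \<le> R" if v: "\<And>i. i < n \<Longrightarrow> 0 \<le> v i" and v1: "(\<Sum>i<n. v i) = 1"
      and q: "\<And>i. i < n \<Longrightarrow> q * v i \<le> M v i" for v q
  proof -
    have vle: "v i \<le> 1" if "i < n" for i
      using member_le_sum[of i "{..<n}" v] v v1 that by auto
    have "q = (\<Sum>i<n. q * v i)" using v1 by (simp add: sum_distrib_left[symmetric])
    also have "\<dots> \<le> (\<Sum>i<n. M v i)" using q by (intro sum_mono) auto
    also have "\<dots> \<le> R" unfolding R_def M_def
    proof (intro sum_mono)
      fix i j assume "i \<in> {..<n}" "j \<in> {..<n}"
      then show "a i j * v j \<le> a i j" using vle[of j] pos[of i j] by (simp add: mult_le_cancel_left1)
    qed
    finally show ?thesis .
  qed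
  have inS: "((\<lambda>i. if i < n then v i else 0), q) \<in> S"
    if v: "\<And>i. i < n \<Longrightarrow> 0 \<le> v i" and v1: "(\<Sum>i<n. v i) = 1"
      and q: "\<And>i. i < n \<Longrightarrow> q * v i \<le> M v i" and q0: "q \<ge> 0" for v q
  proof -
    have "v i \<le> 1" if "i < n" for i
      using member_le_sum[of i "{..<n}" v] v v1 that by auto
    moreover have "M (\<lambda>i. if i < n then v i else 0) = M v"
      unfolding M_def by (intro ext sum.cong) auto
    moreover have "(\<Sum>j<n. if j < n then v j else 0) = 1"
      using v1 by simp
    ultimately show ?thesis unfolding S_def D_def using v q q0 MR[OF v v1 q] by auto
  qed
  have M_scale: "M (\<lambda>j. v j / s) i = M v i / s" for v s i
    unfolding M_def by (simp add: sum_divide_distrib)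
  have M_diff: "M (\<lambda>j. M v j - r * v j) i = M (M v) i - r * M v i" for v r i
  proof -
    have M: "M y i = (\<Sum>j<n. a i j * y j)" for y by (simp add: M_def)
    show ?thesis unfolding M[of "\<lambda>j. M v j - r * v j"] M[of "M v"] M[of v]
      by (simp add: algebra_simps sum_subtractf sum_distrib_left)
  qed
  have M_pos: "M v i > 0" if "i < n" "j < n" "v j > 0" "\<And>j. j < n \<Longrightarrow> v j \<ge> 0" for v i j
    unfolding M_def using that pos
    by (intro sum_pos2[of _ j]) (auto simp: less_imp_le)
  have "S \<noteq> {}"
  proof -
    have "((\<lambda>i. if i < n then 1 / real n else 0), 0) \<in> S"
      using n pos by (intro inS) (auto simp: M_def less_imp_le intro!: sum_nonneg)
    then show ?thesis by blast
  qed
  then obtain p where pS: "p \<in> S" and pmax: "\<And>q. q \<in> S \<Longrightarrow> snd q \<le> snd p"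
    using continuous_attains_sup[OF comp, of snd] continuous_on_snd[OF continuous_on_id] by blast
  define u r where "u = fst p" and "r = snd p"
  have u0: "u i \<ge> 0" for i using pS unfolding S_def D_def u_def by (auto simp: mem_Times_iff PiE_iff)
  have r0: "r \<ge> 0" using pS unfolding S_def D_def r_def by (auto simp: mem_Times_iff)
  have u1: "(\<Sum>j<n. u j) = 1" using pS unfolding S_def u_def by auto
  have ur: "r * u i \<le> M u i" if "i < n" for i using pS that unfolding S_def u_def r_def by auto
  obtain j0 where j0: "j0 < n" "u j0 > 0"
  proof -
    have "\<exists>j<n. u j \<noteq> 0" using u1 by (metis lessThan_iff sum.neutral zero_neq_one)
    then show ?thesis using that u0 by (metis less_eq_real_def)
  qed
  have v0: "M u i > 0" if "i < n" for i using M_pos[where v = u, OF that j0 u0] .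
  have eig: "M u i = r * u i" if i: "i < n" for i
  proof (rule ccontr)
    assume ne: "M u i \<noteq> r * u i"
    define d where "d = (\<lambda>j. M u j - r * u j)"
    have e0: "M d j > 0" if "j < n" for j
      using ur ne i by (intro M_pos[where v = d, OF that i]) (force simp: d_def)+
    \<comment> \<open>the slack, relative to \<open>M u\<close>, by which the value can be raised once \<open>M u\<close> replaces \<open>u\<close>\<close>
    define \<epsilon> where "\<epsilon> = Min ((\<lambda>j. M d j / M u j) ` {..<n})"
    have fin: "finite ((\<lambda>j. M d j / M u j) ` {..<n})" "(\<lambda>j. M d j / M u j) ` {..<n} \<noteq> {}"
      using n by auto
    have \<epsilon>0: "\<epsilon> > 0" unfolding \<epsilon>_def using fin e0 v0 by (subst Min_gr_iff) auto
    have \<epsilon>le: "(r + \<epsilon>) * M u j \<le> M (M u) j" if "j < n" for j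
    proof -
      have "\<epsilon> \<le> M d j / M u j" unfolding \<epsilon>_def using that by (intro Min_le) auto
      then have "\<epsilon> * M u j \<le> M d j" using v0[OF that] by (simp add: pos_le_divide_eq)
      then show ?thesis unfolding d_def M_diff by (simp add: algebra_simps)
    qed
    define s where "s = (\<Sum>j<n. M u j)"
    have s0: "s > 0" unfolding s_def using n v0 by (intro sum_pos) auto
    have "((\<lambda>i. if i < n then M u i / s else 0), r + \<epsilon>) \<in> S"
    proof (rule inS)
      show "0 \<le> M u i / s" if "i < n" for i using v0[OF that] s0 by simp
      show "(\<Sum>i<n. M u i / s) = 1"
        using s0 unfolding sum_divide_distrib[symmetric] s_def[symmetric] by simp
      show "(r + \<epsilon>) * (M u i / s) \<le> M (\<lambda>i. M u i / s) i" if "i < n" for i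
        using \<epsilon>le[OF that] s0 unfolding M_scale by (simp add: divide_right_mono)
      show "0 \<le> r + \<epsilon>" using r0 \<epsilon>0 by simp
    qed
    from pmax[OF this] \<epsilon>0 show False by (simp add: r_def)
  qed
  have "u i > 0" if "i < n" for i
    using eig[OF that] v0[OF that] u0[of i] by (metis less_eq_real_def mult_zero_right)
  with eig show ?thesis unfolding M_def by blast
qed

text \<open>
  Shrink one vector until it touches the other from below. Comparing the two sides at the touching
  index orders the eigenvalues, and exchanging the vectors gives the reverse order. With
  equal eigenvalues the nonnegative difference of the two vectors is mapped to a vector with a
  zero entry, which a positive matrix does only to the zero vector.
\<close>

lemma positive_eigenvector_unique:
  fixes a :: "nat \<Rightarrow> nat \<Rightarrow> real"
  assumes n: "n > 0" and pos: "\<And>i j. i < n \<Longrightarrow> j < n \<Longrightarrow> a i j > 0"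
    and u: "\<And>i. i < n \<Longrightarrow> u i > 0" "\<And>i. i < n \<Longrightarrow> (\<Sum>j<n. a i j * u j) = r * u i"
    and w: "\<And>i. i < n \<Longrightarrow> w i > 0" "\<And>i. i < n \<Longrightarrow> (\<Sum>j<n. a i j * w j) = l * w i"
  shows "\<exists>c>0. \<forall>i<n. w i = c * u i"
proof -
  have touch: "\<exists>c i. c > 0 \<and> i < n \<and> y i = c * x i \<and> (\<forall>j<n. c * x j \<le> y j)"
    if x: "\<And>i. i < n \<Longrightarrow> x i > 0" and y: "\<And>i. i < n \<Longrightarrow> y i > 0" for x y :: "nat \<Rightarrow> real"
  proof -
    obtain i where i: "i < n" and le: "\<And>j. j < n \<Longrightarrow> y i / x i \<le> y j / x j"
    proof -
      define i where "i = arg_min_on (\<lambda>i. y i / x i) {..<n}"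
      have "i \<in> {..<n}" "\<not> (\<exists>j\<in>{..<n}. y j / x j < y i / x i)"
        unfolding i_def using n by (intro arg_min_if_finite; auto)+
      then show ?thesis using that by (metis lessThan_iff not_less)
    qed
    have "y i / x i * x j \<le> y j" if "j < n" for j
      using le[OF that] x[OF that] by (simp add: pos_le_divide_eq)
    moreover have "y i / x i > 0" "y i = y i / x i * x i" using x[OF i] y[OF i] by simp_all
    ultimately show ?thesis using i by blast
  qed
  have le: "m \<le> l'"
    if x: "\<And>i. i < n \<Longrightarrow> x i > 0" "\<And>i. i < n \<Longrightarrow> (\<Sum>j<n. a i j * x j) = m * x i"
      and y: "\<And>i. i < n \<Longrightarrow> y i > 0" "\<And>i. i < n \<Longrightarrow> (\<Sum>j<n. a i j * y j) = l' * y i"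
    for x y m l'
  proof -
    obtain c i where c: "c > 0" "i < n" "y i = c * x i" "\<And>j. j < n \<Longrightarrow> c * x j \<le> y j"
      using touch[where x = x and y = y, OF x(1) y(1)] by blast
    have "c * (m * x i) = (\<Sum>j<n. a i j * (c * x j))"
      using x(2)[OF c(2)] by (simp add: sum_distrib_left mult.left_commute flip: x(2)[OF c(2)])
    also have "\<dots> \<le> (\<Sum>j<n. a i j * y j)"
      using c pos by (intro sum_mono mult_left_mono) (auto intro: less_imp_le)
    also have "\<dots> = l' * (c * x i)" using y(2)[OF c(2)] c(3) by simp
    finally show ?thesis using c(1) x(1)[OF c(2)] by (simp add: mult.left_commute)
  qed
  have lr: "l = r" using le[OF u w] le[OF w u] by simp
  obtain c i where c: "c > 0" "i < n" "w i = c * u i" "\<And>j. j < n \<Longrightarrow> c * u j \<le> w j"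
    using touch[where x = u and y = w, OF u(1) w(1)] by blast
  have "(\<Sum>j<n. a i j * (w j - c * u j)) = (\<Sum>j<n. a i j * w j) - c * (\<Sum>j<n. a i j * u j)"
    by (simp add: algebra_simps sum_subtractf sum_distrib_left)
  also have "\<dots> = 0" using u(2)[OF c(2)] w(2)[OF c(2)] c(3) lr by simp
  finally have "\<forall>j\<in>{..<n}. a i j * (w j - c * u j) = 0"
    using c pos by (subst (asm) sum_nonneg_eq_0_iff) (auto intro!: mult_nonneg_nonneg intro: less_imp_le)
  then have "w j = c * u j" if "j < n" for j using pos[OF c(2) that] that by force
  then show ?thesis using c(1) by blast
qed

lemma perron_vector_iff:
  assumes A: "A \<in> carrier_mat n n" and n: "n > 0"
  shows "perron_vector A w \<longleftrightarrow>
    positive_vec n w \<and> (\<exists>l. \<forall>i<n. (\<Sum>j<n. A $$ (i, j) * w $ j) = l * w $ i)"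
proof (cases "positive_vec n w")
  case True
  have dr: "dim_row A = n" "dim_col A = n" using A by auto
  have dw: "dim_vec w = n" and w0: "w $ 0 > 0" using True n by (auto simp: positive_vec_def)
  have nz: "w \<noteq> 0\<^sub>v n" using w0 n by auto
  have "A *\<^sub>v w = l \<cdot>\<^sub>v w \<longleftrightarrow> (\<forall>i<n. (\<Sum>j<n. A $$ (i, j) * w $ j) = l * w $ i)" for l
    using dr dw by (auto simp: vec_eq_iff scalar_prod_def atLeast0LessThan)
  moreover have "eigenvector A w l \<longleftrightarrow> A *\<^sub>v w = l \<cdot>\<^sub>v w" for l
    unfolding eigenvector_def dr using nz dw by (metis carrier_vecI)
  ultimately show ?thesis
    using True unfolding perron_vector_def dr by blast
next
  case False
  moreover have "dim_row A = n" using A by auto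
  ultimately show ?thesis unfolding perron_vector_def by blast
qed

section \<open>The Perron root of an inconsistent reciprocal matrix\<close>

text \<open>
  The entries \<open>c i j = B i j u j / u i\<close> form a reciprocal matrix with all row sums equal to \<open>r\<close>, so
  \<open>k r\<close> is the sum of all entries. Each pair satisfies \<open>c i j + c j i \<ge> 2\<close>, whence \<open>r \<ge> k\<close>;
  equality forces all \<open>c i j\<close> to be 1, and then \<open>B i j = u i / u j\<close> is consistent.
\<close>

lemma inconsistent_perron_root_gt:
  assumes B: "B \<in> reciprocal_mats k" and inc: "\<not> consistent B"
    and u: "\<And>i. i < k \<Longrightarrow> u i > 0" "\<And>i. i < k \<Longrightarrow> (\<Sum>j<k. B $$ (i, j) * u j) = r * u i"
  shows "r > real k"
proof (rule ccontr)
  assume "\<not> r > real k"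
  then have r: "r \<le> real k" by simp
  have pos: "B $$ (i, j) > 0" and rec: "B $$ (j, i) = 1 / B $$ (i, j)" if "i < k" "j < k" for i j
    using B that unfolding reciprocal_mats_def by blast+
  have dB: "dim_row B = k" using B by (auto simp: reciprocal_mats_def)
  define c where "c = (\<lambda>i j. B $$ (i, j) * u j / u i)"
  have c0: "c i j > 0" and crec: "c j i = 1 / c i j" if "i < k" "j < k" for i j
    using pos[OF that] rec[OF that] u(1) that by (auto simp: c_def)
  have amgm: "c i j + c j i - 2 \<ge> 0" and amgm_eq: "c i j + c j i - 2 = 0 \<Longrightarrow> c i j = 1"
    if "i < k" "j < k" for i j
  proof -
    have e: "c i j + c j i - 2 = (c i j - 1)\<^sup>2 / c i j"
      using c0[OF that] crec[OF that] by (simp add: field_simps power2_eq_square)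
    show "c i j + c j i - 2 \<ge> 0" unfolding e using c0[OF that] by simp
    show "c i j + c j i - 2 = 0 \<Longrightarrow> c i j = 1" unfolding e using c0[OF that] by simp
  qed
  have row: "(\<Sum>j<k. c i j) = r" if "i < k" for i
    using u(2)[OF that] u(1)[OF that] unfolding c_def sum_divide_distrib[symmetric] by simp
  have tot: "(\<Sum>i<k. \<Sum>j<k. c i j) = real k * r" using row by simp
  have "(\<Sum>i<k. \<Sum>j<k. c i j + c j i - 2) = 2 * real k * r - 2 * real k * real k"
    using tot sum.swap[of "\<lambda>i j. c j i" "{..<k}" "{..<k}"]
    by (simp add: sum.distrib sum_subtractf)
  also have "\<dots> \<le> 0" using mult_left_mono[OF r, of "real k"] by simp
  finally have le0: "(\<Sum>i<k. \<Sum>j<k. c i j + c j i - 2) \<le> 0" .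
  have inner: "(\<Sum>j<k. c i j + c j i - 2) \<ge> 0" if "i < k" for i
    using amgm that by (intro sum_nonneg) auto
  have "(\<Sum>i<k. \<Sum>j<k. c i j + c j i - 2) \<ge> 0"
    by (rule sum_nonneg) (use inner in simp)
  with le0 have "(\<Sum>i<k. \<Sum>j<k. c i j + c j i - 2) = 0" by simp
  then have "\<forall>i<k. (\<Sum>j<k. c i j + c j i - 2) = 0"
    using inner by (subst (asm) sum_nonneg_eq_0_iff) auto
  then have zero: "(\<Sum>j<k. c i j + c j i - 2) = 0" if "i < k" for i using that by blast
  have c1: "c i j = 1" if ij: "i < k" "j < k" for i j
  proof -
    have "\<forall>j\<in>{..<k}. c i j + c j i - 2 = 0"
      using zero[OF ij(1)] by (subst (asm) sum_nonneg_eq_0_iff) (use amgm[OF ij(1)] in auto)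
    then show ?thesis using amgm_eq[OF ij] ij by simp
  qed
  have "B $$ (i, j) = u i / u j" if "i < k" "j < k" for i j
    using c1[OF that] u(1)[OF that(1)] u(1)[OF that(2)] by (simp add: c_def field_simps)
  then have "consistent B" unfolding consistent_def dB
    using u(1) by (force simp: field_simps)
  then show False using inc by simp
qed

section \<open>A sufficient condition for inefficiency\<close>

text \<open>
  If all approximations off the diagonal in row \<open>s\<close> fall short of the matrix entries, then those in
  column \<open>s\<close> are too large by reciprocity. Multiplying the weight of \<open>s\<close> by a factor
  \<open>c > 1\<close> improves them all and leaves the others unchanged. The largest
  admissible \<open>c\<close> is the one that makes the first approximation exact.
\<close>

lemma inefficient_if_dominated_entry:
  assumes A: "A \<in> reciprocal_mats n" and n: "n \<ge> 2" and w: "positive_vec n w" and s: "s < n"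
    and dom: "\<And>j. j < n \<Longrightarrow> j \<noteq> s \<Longrightarrow> w $ s < A $$ (s, j) * w $ j"
  shows "inefficient A w"
proof -
  have dA: "dim_row A = n" using A by (auto simp: reciprocal_mats_def)
  have rec: "A $$ (j, i) = 1 / A $$ (i, j)" "A $$ (i, j) > 0" if "i < n" "j < n" for i j
    using A that unfolding reciprocal_mats_def by blast+
  have wp: "w $ i > 0" if "i < n" for i using w that by (auto simp: positive_vec_def)
  have dw: "dim_vec w = n" using w by (auto simp: positive_vec_def)
  define T where "T = (\<lambda>j. A $$ (s, j) * w $ j / w $ s) ` ({..<n} - {s})"
  \<comment> \<open>an index other than \<open>s\<close>, needed both for \<open>c\<close> to be a minimum of a nonempty set and for \<open>v\<close> not to be
     a multiple of \<open>w\<close>\<close>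
  have "(if s = 0 then 1 else 0) \<in> {..<n} - {s}" using n by auto
  then have T: "finite T" "T \<noteq> {}" unfolding T_def by auto
  define c where "c = Min T"
  have c1: "c > 1" unfolding c_def using T dom wp[OF s] by (subst Min_gr_iff) (auto simp: T_def)
  have cle: "c * w $ s \<le> A $$ (s, j) * w $ j" if "j < n" "j \<noteq> s" for j
  proof -
    have "c \<le> A $$ (s, j) * w $ j / w $ s"
      unfolding c_def using T that by (intro Min_le) (auto simp: T_def)
    then show ?thesis using wp[OF s] by (simp add: pos_le_divide_eq)
  qed
  define v where "v = vec n (\<lambda>i. if i = s then c * w $ s else w $ i)"
  have v: "positive_vec n v" using wp c1 by (auto simp: v_def positive_vec_def)
  have closer: "\<bar>A $$ (i, j) - v $ i / v $ j\<bar> \<le> \<bar>A $$ (i, j) - w $ i / w $ j\<bar>"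
    if ij: "i < n" "j < n" for i j
  proof -
    consider "i = s" "j \<noteq> s" | "i \<noteq> s" "j = s" | "i = s" "j = s" | "i \<noteq> s" "j \<noteq> s" by blast
    then show ?thesis
    proof cases
      case 1
      have "c * w $ s / w $ j \<le> A $$ (s, j)"
        using cle[OF ij(2) 1(2)] wp[OF ij(2)] by (simp add: pos_divide_le_eq)
      moreover have "w $ s / w $ j \<le> c * w $ s / w $ j"
        using c1 wp[OF s] wp[OF ij(2)] by (simp add: divide_right_mono)
      ultimately show ?thesis using 1 ij by (simp add: v_def)
    next
      case 2
      have "A $$ (i, s) \<le> w $ i / (c * w $ s)"
        using cle[OF ij(1) 2(1)] rec(2)[OF s ij(1)] wp[OF s] wp[OF ij(1)] c1
        unfolding rec(1)[OF s ij(1)] by (simp add: field_simps)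
      moreover have "w $ i / (c * w $ s) \<le> w $ i / w $ s"
        using c1 wp[OF s] wp[OF ij(1)] by (simp add: field_simps)
      ultimately show ?thesis using 2 ij by (simp add: v_def)
    next
      case 3
      then show ?thesis using s wp[OF s] c1 by (simp add: v_def)
    next
      case 4
      then show ?thesis using ij by (simp add: v_def)
    qed
  qed
  have "\<not> (\<exists>d>0. v = d \<cdot>\<^sub>v w)"
  proof
    assume "\<exists>d>0. v = d \<cdot>\<^sub>v w"
    then obtain d where d: "v = d \<cdot>\<^sub>v w" by blast
    obtain j where j: "j < n" "j \<noteq> s" using \<open>_ \<in> {..<n} - {s}\<close> by blast
    have "v $ s = d * w $ s" "v $ j = d * w $ j" using d s j dw by auto
    then show False using s j wp[OF s] wp[OF j(1)] c1 by (simp add: v_def)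
  qed
  then show ?thesis unfolding inefficient_def efficient_def dA using w v closer by blast
qed

section \<open>Extending a reciprocal matrix by one row and column\<close>

definition border :: "real mat \<Rightarrow> (nat \<Rightarrow> real) \<Rightarrow> real mat" where
  "border B x = mat (Suc (dim_row B)) (Suc (dim_row B)) (\<lambda>(i, j).
     if i < dim_row B then (if j < dim_row B then B $$ (i, j) else x i)
     else (if j < dim_row B then 1 / x j else 1))"

lemma border_eq:
  assumes B: "B \<in> reciprocal_mats k"
  shows "i < k \<Longrightarrow> j < k \<Longrightarrow> border B x $$ (i, j) = B $$ (i, j)"
    and "i < k \<Longrightarrow> border B x $$ (i, k) = x i"
    and "j < k \<Longrightarrow> border B x $$ (k, j) = 1 / x j"
    and "border B x $$ (k, k) = 1"
proof -
  have "dim_row B = k" using B by (auto simp: reciprocal_mats_def)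
  then show "i < k \<Longrightarrow> j < k \<Longrightarrow> border B x $$ (i, j) = B $$ (i, j)"
    and "i < k \<Longrightarrow> border B x $$ (i, k) = x i"
    and "j < k \<Longrightarrow> border B x $$ (k, j) = 1 / x j"
    and "border B x $$ (k, k) = 1"
    by (simp_all add: border_def)
qed

lemma border_reciprocal:
  assumes B: "B \<in> reciprocal_mats k" and x: "\<And>i. i < k \<Longrightarrow> x i > 0"
  shows "border B x \<in> reciprocal_mats (Suc k)"
proof -
  have dB: "dim_row B = k" using B by (auto simp: reciprocal_mats_def)
  have entry: "border B x $$ (i, j) > 0 \<and> border B x $$ (j, i) = 1 / border B x $$ (i, j)"
    if ij: "i < Suc k" "j < Suc k" for i j
  proof -
    consider "i < k" "j < k" | "i < k" "j = k" | "i = k" "j < k" | "i = k" "j = k"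
      using ij by (auto simp: less_Suc_eq)
    then show ?thesis
    proof cases
      case 1
      then have "B $$ (i, j) > 0 \<and> B $$ (j, i) = 1 / B $$ (i, j)"
        using B unfolding reciprocal_mats_def by blast
      then show ?thesis using 1 by (simp only: border_eq[OF B])
    qed (use x in \<open>simp_all add: border_eq[OF B]\<close>)
  qed
  have "border B x \<in> carrier_mat (Suc k) (Suc k)" by (simp add: border_def dB)
  with entry show ?thesis unfolding reciprocal_mats_def by blast
qed

text \<open>
  With new column \<open>t u\<close>, the positive vector \<open>(u, 1)\<close> is an eigenvector exactly when
  \<open>t (t + r - 1) = k\<close>. The left side is 0 at \<open>t = 0\<close> and \<open>r > k\<close> at \<open>t = 1\<close>, so a root with
  \<open>0 < t < 1\<close> exists. For such \<open>t\<close> the last row consists of the entries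
  \<open>1 / (t u j) > 1 / u j\<close>, and the last index satisfies the condition for inefficiency.
\<close>

lemma inefficient_border:
  assumes k: "k \<ge> 1" and B: "B \<in> reciprocal_mats k" and inc: "\<not> consistent B"
  shows "\<exists>x. (\<forall>i<k. x i > 0) \<and> (\<exists>w. perron_vector (border B x) w) \<and>
           (\<forall>w. perron_vector (border B x) w \<longrightarrow> inefficient (border B x) w)"
proof -
  have pos: "B $$ (i, j) > 0" if "i < k" "j < k" for i j
    using B that unfolding reciprocal_mats_def by blast
  have "k > 0" using k by simp
  then obtain u r where u: "\<And>i. i < k \<Longrightarrow> u i > 0"
    "\<And>i. i < k \<Longrightarrow> (\<Sum>j<k. B $$ (i, j) * u j) = r * u i"
    using positive_eigenvector_exists[of k "\<lambda>i j. B $$ (i, j)", OF _ pos] by metis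
  have rk: "r > real k" using inconsistent_perron_root_gt[OF B inc u] .
  obtain t where t: "0 \<le> t" "t \<le> 1" "t * (t + r - 1) = real k"
  proof -
    have "\<exists>t. 0 \<le> t \<and> t \<le> 1 \<and> t * (t + r - 1) = real k"
    proof (rule IVT')
      show "continuous_on {0..1} (\<lambda>t. t * (t + r - 1))" by (intro continuous_intros)
    qed (use rk in auto)
    then show ?thesis using that by blast
  qed
  have t0: "t > 0" using t k by (cases "t = 0") auto
  have t1: "t < 1" using t rk by (cases "t = 1") auto
  define x where "x = (\<lambda>i. t * u i)"
  define A where "A = border B x"
  define y where "y = (\<lambda>i. if i < k then u i else 1)"
  have x0: "x i > 0" if "i < k" for i using u t0 that by (simp add: x_def)
  have A: "A \<in> reciprocal_mats (Suc k)" unfolding A_def by (rule border_reciprocal[OF B x0])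
  then have Ac: "A \<in> carrier_mat (Suc k) (Suc k)"
    and Apos: "\<And>i j. i < Suc k \<Longrightarrow> j < Suc k \<Longrightarrow> A $$ (i, j) > 0"
    unfolding reciprocal_mats_def by blast+
  have y0: "y i > 0" if "i < Suc k" for i using u(1) by (auto simp: y_def)
  have yeig: "(\<Sum>j<Suc k. A $$ (i, j) * y j) = (t + r) * y i" if "i < Suc k" for i
  proof (cases "i < k")
    case True
    then have "(\<Sum>j<k. A $$ (i, j) * y j) = (\<Sum>j<k. B $$ (i, j) * u j)"
      by (intro sum.cong) (auto simp: A_def border_eq[OF B] y_def)
    then show ?thesis using True u(2)[OF True]
      by (simp add: A_def border_eq[OF B] y_def x_def algebra_simps)
  next
    case False
    then have ik: "i = k" using that by simp
    have "(\<Sum>j<k. A $$ (k, j) * y j) = (\<Sum>j<k. 1 / t)"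
      using u(1) by (intro sum.cong) (auto simp: A_def border_eq[OF B] y_def x_def less_imp_neq[THEN not_sym])
    also have "\<dots> = t + r - 1" using t(3) t0 by (simp add: field_simps)
    finally show ?thesis by (simp add: ik A_def border_eq[OF B] y_def)
  qed
  have "perron_vector A (vec (Suc k) y)"
    unfolding perron_vector_iff[OF Ac zero_less_Suc]
    using y0 yeig by (auto simp: positive_vec_def intro!: exI[of _ "t + r"])
  moreover have "inefficient A w" if "perron_vector A w" for w
  proof -
    from that obtain l where w: "positive_vec (Suc k) w"
      and l: "\<And>i. i < Suc k \<Longrightarrow> (\<Sum>j<Suc k. A $$ (i, j) * w $ j) = l * w $ i"
      unfolding perron_vector_iff[OF Ac zero_less_Suc] by blast
    have w0: "\<And>i. i < Suc k \<Longrightarrow> w $ i > 0" using w by (auto simp: positive_vec_def)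
    obtain c where c: "c > 0" "\<And>i. i < Suc k \<Longrightarrow> w $ i = c * y i"
      using positive_eigenvector_unique[of "Suc k" "\<lambda>i j. A $$ (i, j)" y "t + r" "\<lambda>i. w $ i" l]
        Apos y0 yeig w0 l by blast
    show ?thesis
    proof (rule inefficient_if_dominated_entry[OF A _ w lessI])
      show "2 \<le> Suc k" using k by simp
      fix j assume "j < Suc k" "j \<noteq> k"
      then have j: "j < k" by simp
      then have "A $$ (k, j) * w $ j = c / t"
        using c(2)[of j] u(1)[OF j] by (simp add: A_def border_eq[OF B] y_def x_def)
      moreover have "w $ k = c" using c(2)[of k] by (simp add: y_def)
      moreover have "c < c / t" using c(1) t0 t1 by (simp add: pos_less_divide_eq)
      ultimately show "w $ k < A $$ (k, j) * w $ j" by simp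
    qed
  qed
  ultimately show ?thesis using x0 unfolding A_def by blast
qed

section \<open>Leading blocks of inconsistent matrices\<close>

lemma reciprocal_extension:
  assumes B: "B \<in> reciprocal_mats k" and "k \<le> m"
  shows "\<exists>C \<in> reciprocal_mats m. \<forall>i<k. \<forall>j<k. C $$ (i, j) = B $$ (i, j)"
  using assms(2)
proof (induction m rule: dec_induct)
  case base
  then show ?case using B by blast
next
  case (step m)
  then obtain C where C: "C \<in> reciprocal_mats m" "\<forall>i<k. \<forall>j<k. C $$ (i, j) = B $$ (i, j)" by blast
  have "border C (\<lambda>_. 1) \<in> reciprocal_mats (Suc m)" using C(1) by (rule border_reciprocal) simp
  moreover have "\<forall>i<k. \<forall>j<k. border C (\<lambda>_. 1) $$ (i, j) = B $$ (i, j)"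
    using C step.hyps by (auto simp: border_eq[OF C(1)])
  ultimately show ?case by blast
qed

text \<open>
  Only the last column needs care: the triple formed by the indices 0, \<open>m - 1\<close> and 1 has product
  \<open>2 D (0, 1)\<close> instead of \<open>D (0, 1)\<close>. It consists of three different indices because \<open>m \<ge> 3\<close>.
\<close>

lemma inconsistent_extension:
  assumes B: "B \<in> reciprocal_mats k" and km: "k < m" and m: "m \<ge> 3"
  shows "\<exists>C \<in> reciprocal_mats m. \<not> consistent C \<and> (\<forall>i<k. \<forall>j<k. C $$ (i, j) = B $$ (i, j))"
proof -
  obtain p where p: "m = Suc p" "k \<le> p" "p \<ge> 2" using km m by (cases m) auto
  obtain D where D: "D \<in> reciprocal_mats p" "\<forall>i<k. \<forall>j<k. D $$ (i, j) = B $$ (i, j)"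
    using reciprocal_extension[OF B p(2)] by blast
  have "0 < p" "1 < p" using p(3) by auto
  then have D01: "D $$ (0, 1) > 0" using D(1) unfolding reciprocal_mats_def by blast
  define x where "x = (\<lambda>i::nat. if i = 0 then 2 * D $$ (0, 1) else 1)"
  define C where "C = border D x"
  have C: "C \<in> reciprocal_mats m" unfolding C_def p(1)
    using D(1) by (rule border_reciprocal) (use D01 in \<open>simp add: x_def\<close>)
  have dC: "dim_row C = m" using C by (auto simp: reciprocal_mats_def)
  have "C $$ (0, p) * C $$ (p, 1) = 2 * D $$ (0, 1)" "C $$ (0, 1) = D $$ (0, 1)"
    using p(3) by (auto simp: C_def border_eq[OF D(1)] x_def)
  then have "C $$ (0, p) * C $$ (p, 1) \<noteq> C $$ (0, 1)" using D01 by simp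
  moreover have "0 < m" "p < m" "1 < m" using p by auto
  ultimately have "\<not> consistent C" unfolding consistent_def dC by blast
  moreover have "\<forall>i<k. \<forall>j<k. C $$ (i, j) = B $$ (i, j)"
    using D(2) p(2) by (auto simp: C_def border_eq[OF D(1)])
  ultimately show ?thesis using C by blast
qed

lemma submatrix_leading:
  assumes A: "A \<in> carrier_mat n n" and B: "B \<in> carrier_mat k k" and kn: "k \<le> n"
    and eq: "\<And>i j. i < k \<Longrightarrow> j < k \<Longrightarrow> A $$ (i, j) = B $$ (i, j)"
  shows "submatrix A {..<k} {..<k} = B"
proof (rule eq_matI)
  have "{i. i < n \<and> i \<in> {..<k}} = {..<k}" using kn by auto
  then have d: "dim_row (submatrix A {..<k} {..<k}) = k" "dim_col (submatrix A {..<k} {..<k}) = k"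
    using A by (simp_all add: dim_submatrix)
  then show "dim_row (submatrix A {..<k} {..<k}) = dim_row B"
    "dim_col (submatrix A {..<k} {..<k}) = dim_col B" using B by auto
  fix i j assume "i < dim_row B" "j < dim_col B"
  then have ij: "i < k" "j < k" using B by auto
  have "card {a \<in> {..<k}. a < q} = q" if "q < k" for q
  proof -
    have "{a \<in> {..<k}. a < q} = {..<q}" using that by auto
    then show ?thesis by simp
  qed
  then show "submatrix A {..<k} {..<k} $$ (i, j) = B $$ (i, j)"
    using submatrix_index_card[of i A j "{..<k}" "{..<k}"] ij A kn eq by auto
qed

section \<open>Extensions with an inefficient Perron vector\<close>

theorem mainTheorem5:
  fixes n k :: nat and B :: "real mat"
  assumes "1 \<le> k" and "k < n"
    and "B \<in> reciprocal_mats k"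
    and "k = n - 1 \<Longrightarrow> \<not> consistent B"
    and "\<not> (k = 1 \<and> n = 3)"
  shows "\<exists>A \<in> reciprocal_mats n. submatrix A {..<k} {..<k} = B \<and>
           (\<exists>w. perron_vector A w) \<and> (\<forall>w. perron_vector A w \<longrightarrow> inefficient A w)"
proof -
  obtain m where m: "n = Suc m" "k \<le> m" using assms(2) by (cases n) auto
  obtain C where C: "C \<in> reciprocal_mats m" "\<not> consistent C"
    and CB: "\<forall>i<k. \<forall>j<k. C $$ (i, j) = B $$ (i, j)"
  proof (cases "k = m")
    case True
    then show ?thesis using that[of B] assms m by auto
  next
    case False
    then have "k < m" "m \<ge> 3" using assms(1,5) m by auto
    then show ?thesis using inconsistent_extension[OF assms(3)] that by blast
  qed
  have "m \<ge> 1" using assms(1) m by simp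
  then obtain x where x: "\<forall>i<m. x i > 0" "\<exists>w. perron_vector (border C x) w"
    "\<forall>w. perron_vector (border C x) w \<longrightarrow> inefficient (border C x) w"
    using inefficient_border[OF _ C] by blast
  have A: "border C x \<in> reciprocal_mats n" unfolding m(1)
    using C(1) by (rule border_reciprocal) (use x(1) in blast)
  moreover have "submatrix (border C x) {..<k} {..<k} = B"
  proof (rule submatrix_leading)
    show "border C x \<in> carrier_mat n n" using A by (simp add: reciprocal_mats_def)
    show "B \<in> carrier_mat k k" using assms(3) by (simp add: reciprocal_mats_def)
    show "k \<le> n" using assms(2) by simp
    show "border C x $$ (i, j) = B $$ (i, j)" if "i < k" "j < k" for i j
      using that m(2) CB by (simp add: border_eq[OF C(1)])
  qed
  ultimately show ?thesis using x(2,3) by blast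
qed

end
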